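(* Let $\mathbb{D},\mathbb{D}'$ be division rings and let $m,n,m',n'\ge 2$ be integers. Let $\phi:\mathbb{D}^{m\times n}\to\mathbb{D}'^{m'\times n'}$ be an additive graph homomorphism. Then one of the following holds: (1) there exist matrices $P\in\mathbb{D}'^{m'\times m}$ and $Q\in\mathbb{D}'^{n\times n'}$, each of rank $\ge 2$, and a nonzero ring homomorphism $\tau:\mathbb{D}\to\mathbb{D}'$ such that $\phi(X)=PX^{\tau}Q$ for all $X\in\mathbb{D}^{m\times n}$; (2) there exist matrices $P\in\mathbb{D}'^{m'\times n}$ and $Q\in\mathbb{D}'^{m\times n'}$, each of rank $\ge 2$, and a nonzero ring anti-homomorphism $\sigma:\mathbb{D}\to\mathbb{D}'$ such that $\phi(X)=P\,{}^tX^{\sigma}Q$ for all $X\in\mathbb{D}^{m\times n}$; (3) $\phi$ is a (vertex) colouring.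
   Context: For a division ring $\mathbb{D}$, $\mathbb{D}^{m\times n}$ is the set of $m\times n$ matrices over $\mathbb{D}$, with the usual rank of matrices over a division ring. $A,B\in\mathbb{D}^{m\times n}$ are adjacent, written $A\sim B$, if $\mathrm{rank}(A-B)=1$. A map $\phi:\mathbb{D}^{m\times n}\to\mathbb{D}'^{m'\times n'}$ is a graph homomorphism if $A\sim B$ implies $\phi(A)\sim\phi(B)$; it is additive if $\phi(A+B)=\phi(A)+\phi(B)$ for all $A,B$; an additive graph homomorphism is a map that is both. An adjacent set is a nonempty set of matrices any two distinct members of which are adjacent. A graph homomorphism $\phi$ is a (vertex) colouring if its image $\phi(\mathbb{D}^{m\times n})$ is an adjacent set in $\mathbb{D}'^{m'\times n'}$. For a map $\sigma:\mathbb{D}\to\mathbb{D}'$ and $X=(x_{ij})$, $X^{\sigma}=(\sigma(x_{ij}))$ is obtained entrywise, and ${}^tX^{\sigma}={}^t(X^{\sigma})$ is its transpose. *)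

theory Defs
  imports "HOL-Analysis.Analysis"
begin

(* The library's rank needs a commutative field of scalars. Over a division ring the
   usual rank is the left row rank (which equals the right column rank): scalars act on
   rows from the left, and ( *s ) is left scalar multiplication. Independence is stated for
   families of rows indexed by a set I, so a repeated row makes the family dependent. *)

definition left_indep_rows :: "'a::division_ring^'n^'m \<Rightarrow> 'm set \<Rightarrow> bool" where
  "left_indep_rows A I \<longleftrightarrow>
     (\<forall>c. (\<Sum>i\<in>I. c i *s row i A) = 0 \<longrightarrow> (\<forall>i\<in>I. c i = 0))"

definition drank :: "'a::division_ring^'n^'m \<Rightarrow> nat" where
  "drank A = Max (card ` {I. left_indep_rows A I})"

definition adjacent :: "'a::division_ring^'n^'m \<Rightarrow> 'a^'n^'m \<Rightarrow> bool" where
  "adjacent A B \<longleftrightarrow> drank (A - B) = 1"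

definition graph_hom :: "('a::division_ring^'n^'m \<Rightarrow> 'b::division_ring^'q^'p) \<Rightarrow> bool" where
  "graph_hom \<phi> \<longleftrightarrow> (\<forall>A B. adjacent A B \<longrightarrow> adjacent (\<phi> A) (\<phi> B))"

definition adjacent_set :: "('a::division_ring^'n^'m) set \<Rightarrow> bool" where
  "adjacent_set S \<longleftrightarrow> S \<noteq> {} \<and> (\<forall>A\<in>S. \<forall>B\<in>S. A \<noteq> B \<longrightarrow> adjacent A B)"

definition colouring :: "('a::division_ring^'n^'m \<Rightarrow> 'b::division_ring^'q^'p) \<Rightarrow> bool" where
  "colouring \<phi> \<longleftrightarrow> graph_hom \<phi> \<and> adjacent_set (range \<phi>)"

(* Preservation of 1 is not required; between division rings it follows for nonzero maps. *)

definition nonzero_ring_hom :: "('a::division_ring \<Rightarrow> 'b::division_ring) \<Rightarrow> bool" where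
  "nonzero_ring_hom \<tau> \<longleftrightarrow>
     (\<forall>x y. \<tau> (x + y) = \<tau> x + \<tau> y) \<and> (\<forall>x y. \<tau> (x * y) = \<tau> x * \<tau> y) \<and> (\<exists>x. \<tau> x \<noteq> 0)"

definition nonzero_ring_antihom :: "('a::division_ring \<Rightarrow> 'b::division_ring) \<Rightarrow> bool" where
  "nonzero_ring_antihom \<sigma> \<longleftrightarrow>
     (\<forall>x y. \<sigma> (x + y) = \<sigma> x + \<sigma> y) \<and> (\<forall>x y. \<sigma> (x * y) = \<sigma> y * \<sigma> x) \<and> (\<exists>x. \<sigma> x \<noteq> 0)"

end

theory Submission
  imports Defs
begin

text \<open>Write \<open>\<phi> (x y) = u w\<close> for a column \<open>x\<close>, a row \<open>y\<close> and some column \<open>u\<close> and row \<open>w\<close>.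
  An additive group of matrices of rank at most one has a common column line or a common row
  line. Since a group is not the union of two proper subgroups, either for every \<open>x\<close> the column
  line of \<open>\<phi> (x y)\<close> does not depend on \<open>y\<close>, or for every \<open>x\<close> its row line does not. If that line does
  not depend on \<open>x\<close> either, all values of \<open>\<phi>\<close> have rank at most one and \<open>\<phi>\<close> is a colouring.
  Otherwise the factors can be chosen additively, as \<open>u x\<close> and \<open>w y\<close> in the first case and as
  \<open>u y\<close> and \<open>w x\<close> in the second. Comparing \<open>\<phi> ((x a) y)\<close> with \<open>\<phi> (x (a y))\<close> shows that both
  factors are semilinear for the same map of scalars, which is multiplicative in the first case
  and antimultiplicative in the second.\<close>

text \<open>If \<open>a\<close> violates \<open>P\<close> and \<open>b\<close> violates
  \<open>Q\<close>, then \<open>Q a\<close> and \<open>P b\<close> hold, and subtracting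
  \<open>b\<close> or \<open>a\<close> from \<open>a + b\<close> shows that \<open>a + b\<close>
  satisfies neither.\<close>

lemma subgroup_union_UNIV:
  fixes P Q :: "'a::ab_group_add \<Rightarrow> bool"
  assumes "\<And>x y. P x \<Longrightarrow> P y \<Longrightarrow> P (x - y)" and "\<And>x y. Q x \<Longrightarrow> Q y \<Longrightarrow> Q (x - y)"
    and "\<And>x. P x \<or> Q x"
  shows "(\<forall>x. P x) \<or> (\<forall>x. Q x)"
proof (rule ccontr)
  assume "\<not> ?thesis"
  then obtain a b where ab: "\<not> P a" "\<not> Q b" by blast
  show False
    using assms(1)[of "a + b" b] assms(2)[of "a + b" a] assms(3)[of "a + b"]
      assms(3)[of a] assms(3)[of b] ab by auto
qed

section \<open>Outer products of a column and a row\<close>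

definition outer :: "'a::times^'m \<Rightarrow> 'a^'n \<Rightarrow> 'a^'n^'m" where
  "outer u w = (\<chi> i j. u $ i * w $ j)"

text \<open>Columns form a right vector space and rows a left one. With scalars on these sides, a
  scalar passes through the middle of an outer product as through a tensor product.\<close>

definition rscale :: "'a::times \<Rightarrow> 'a^'n \<Rightarrow> 'a^'n" where
  "rscale s u = (\<chi> i. u $ i * s)"

lemma outer_nth [simp]: "outer u w $ i $ j = u $ i * w $ j"
  by (simp add: outer_def)

lemma rscale_nth [simp]: "rscale s u $ i = u $ i * s"
  by (simp add: rscale_def)

lemma rscale_1 [simp]: "rscale 1 u = (u :: 'a::ring_1^'n)"
  by (simp add: vec_eq_iff)

lemma outer_eq_0_iff:
  fixes u :: "'a::division_ring^'m" and w :: "'a^'n"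
  shows "outer u w = 0 \<longleftrightarrow> u = 0 \<or> w = 0"
  by (auto simp: vec_eq_iff)

lemma outer_add_left: "outer (u + u') w = outer u w + outer u' (w :: 'a::ring^'n)"
  and outer_add_right: "outer u (w + w') = outer u w + outer u (w' :: 'a::ring^'n)"
  by (simp_all add: vec_eq_iff algebra_simps)

lemma outer_rscale: "outer (rscale s u) w = outer u (s *s (w :: 'a::ring_1^'n))"
  by (simp add: vec_eq_iff mult.assoc)

lemma matrix_mult_outer_mult:
  fixes P :: "'a::ring_1^'m^'p" and Q :: "'a^'q^'n"
  shows "P ** outer a b ** Q =
    outer (\<chi> k. \<Sum>i\<in>UNIV. P $ k $ i * a $ i) (\<chi> l. \<Sum>j\<in>UNIV. b $ j * Q $ j $ l)"
proof -
  have "(P ** outer a b) $ k $ j = (\<Sum>i\<in>UNIV. P $ k $ i * a $ i) * b $ j" for k j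
    by (simp add: matrix_matrix_mult_def sum_distrib_right mult.assoc)
  then show ?thesis
    by (simp add: vec_eq_iff matrix_matrix_mult_def[of "P ** outer a b"] sum_distrib_left mult.assoc)
qed

text \<open>If \<open>w\<close> and \<open>w'\<close> are left independent, a row with
  \<open>u $ i \<noteq> 0\<close> expresses \<open>w''\<close> as a combination of them with
  coefficients \<alpha> and \<beta>. Comparing coefficients in every row gives u = u'' \<alpha> and
  u' = u'' \<beta>, where \<alpha> is invertible.\<close>

lemma outer_plus_outer_rank_one:
  fixes u u' u'' :: "'a::division_ring^'m" and w w' w'' :: "'a^'n"
  assumes eq: "outer u w + outer u' w' = outer u'' w''" and "u \<noteq> 0" "w \<noteq> 0"
  shows "(\<exists>s. u' = rscale s u) \<or> (\<exists>s. w' = s *s w)"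
proof (rule disjCI)
  assume "\<nexists>s. w' = s *s w"
  then have indep: "\<alpha> = 0 \<and> \<beta> = 0" if "\<And>j. \<alpha> * w $ j + \<beta> * w' $ j = 0" for \<alpha> \<beta>
  proof -
    have "\<beta> = 0"
    proof (rule ccontr)
      assume b: "\<beta> \<noteq> 0"
      have "w' $ j = (- (inverse \<beta> * \<alpha>)) * w $ j" for j
      proof -
        have "\<beta> * w' $ j = - (\<alpha> * w $ j)" using that[of j] by (simp add: eq_neg_iff_add_eq_0 add.commute)
        then have "inverse \<beta> * (\<beta> * w' $ j) = inverse \<beta> * - (\<alpha> * w $ j)" by simp
        then show ?thesis using b by (simp add: mult.assoc[symmetric])
      qed
      then have "w' = (- (inverse \<beta> * \<alpha>)) *s w" by (simp add: vec_eq_iff)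
      with \<open>\<nexists>s. w' = s *s w\<close> show False by blast
    qed
    moreover have "\<alpha> = 0" using \<open>\<beta> = 0\<close> that \<open>w \<noteq> 0\<close> by (auto simp: vec_eq_iff)
    ultimately show ?thesis by simp
  qed
  have row: "u $ i * w $ j + u' $ i * w' $ j = u'' $ i * w'' $ j" for i j
    using arg_cong[OF eq, of "\<lambda>M. M $ i $ j"] by simp
  obtain i where i: "u $ i \<noteq> 0" using \<open>u \<noteq> 0\<close> by (auto simp: vec_eq_iff)
  have u''i: "u'' $ i \<noteq> 0"
    using indep[of "u $ i" "u' $ i"] i row[of i] by auto
  define \<alpha> \<beta> where "\<alpha> = inverse (u'' $ i) * u $ i" and "\<beta> = inverse (u'' $ i) * u' $ i"
  have w'': "w'' $ j = \<alpha> * w $ j + \<beta> * w' $ j" for j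
    using arg_cong[OF row[of i j], of "\<lambda>t. inverse (u'' $ i) * t"] u''i
    by (simp add: \<alpha>_def \<beta>_def mult.assoc distrib_left) (simp add: mult.assoc[symmetric])
  have "u $ k - u'' $ k * \<alpha> = 0 \<and> u' $ k - u'' $ k * \<beta> = 0" for k
    by (rule indep) (use row[of k] in \<open>simp add: w'' algebra_simps\<close>)
  moreover have "\<alpha> \<noteq> 0" using i u''i by (simp add: \<alpha>_def)
  ultimately have "u' $ k = u $ k * (inverse \<alpha> * \<beta>)" for k
    by (metis (no_types, opaque_lifting) eq_iff_diff_eq_0 mult.assoc mult_1_right right_inverse)
  then show "\<exists>s. u' = rscale s u" by (intro exI[of _ "inverse \<alpha> * \<beta>"]) (simp add: vec_eq_iff)
qed

section \<open>Matrices of small rank\<close>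

lemma drank_le_1_iff:
  fixes A :: "'a::division_ring^'n^'m"
  shows "drank A \<le> 1 \<longleftrightarrow> (\<exists>u w. A = outer u w)"
proof
  assume le: "drank A \<le> 1"
  have card_le: "card I \<le> 1" if "left_indep_rows A I" for I
  proof -
    have "card I \<le> drank A" unfolding drank_def
      by (rule Max_ge) (use that in auto)
    with le show ?thesis by simp
  qed
  show "\<exists>u w. A = outer u w"
  proof (cases "A = 0")
    case True
    then have "A = outer 0 0" by (simp add: outer_eq_0_iff)
    then show ?thesis by blast
  next
    case False
    then obtain i where i: "row i A \<noteq> 0" by (auto simp: vec_eq_iff row_def)
    \<comment> \<open>Rows with distinct indices are dependent, and since row \<open>i\<close> is
      nonzero the relation can be solved for row \<open>k\<close>. The factors will form the column
      of the outer product.\<close>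
    have "\<exists>s. row k A = s *s row i A" for k
    proof (cases "k = i")
      case True
      then have "row k A = 1 *s row i A" by simp
      then show ?thesis by blast
    next
      case ki: False
      then have "card {i, k} = 2" by auto
      with card_le have "\<not> left_indep_rows A {i, k}" by fastforce
      then obtain c where c: "c i *s row i A + c k *s row k A = 0" "c i \<noteq> 0 \<or> c k \<noteq> 0"
        unfolding left_indep_rows_def using ki by auto
      have ck: "c k \<noteq> 0"
        using c i by (auto simp: vec_eq_iff)
      have "row k A $ j = - (inverse (c k) * c i) * row i A $ j" for j
      proof -
        have "c i * row i A $ j + c k * row k A $ j = 0"
          using c(1) by (simp add: vec_eq_iff)
        then have "c k * row k A $ j = - (c i * row i A $ j)"
          by (simp add: eq_neg_iff_add_eq_0 add.commute)
        then have "inverse (c k) * (c k * row k A $ j) = inverse (c k) * - (c i * row i A $ j)"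
          by simp
        then show ?thesis using ck by (simp add: mult.assoc[symmetric])
      qed
      then have "row k A = (- (inverse (c k) * c i)) *s row i A" by (simp add: vec_eq_iff)
      then show ?thesis by blast
    qed
    then obtain s where s: "\<And>k. row k A = s k *s row i A" by metis
    have "A $ k $ j = s k * row i A $ j" for k j
      using arg_cong[OF s[of k], of "\<lambda>v. v $ j"] by (simp add: row_def)
    then have "A = outer (\<chi> k. s k) (row i A)" by (simp add: vec_eq_iff)
    then show ?thesis by (intro exI)
  qed
next
  assume "\<exists>u w. A = outer u w"
  then obtain u w where A: "A = outer u w" by blast
  have row: "row i A = u $ i *s w" for i by (simp add: A row_def vec_eq_iff)
  have "card I \<le> 1" if I: "left_indep_rows A I" for I
  proof (rule ccontr)
    assume "\<not> card I \<le> 1"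
    then obtain i k where ik: "i \<in> I" "k \<in> I" "i \<noteq> k"
      by (metis One_nat_def card_le_Suc0_iff_eq finite_class.finite)
    \<comment> \<open>A zero row \<open>i\<close> is a relation by itself; otherwise row
      \<open>k\<close> is cancelled by a left multiple of row \<open>i\<close>.\<close>
    define c where "c j = (if j = i then (if u $ i = 0 then 1 else - (u $ k * inverse (u $ i)))
      else if j = k then (if u $ i = 0 then 0 else 1) else 0)" for j
    have "(\<Sum>j\<in>I. c j *s row j A) = (\<Sum>j\<in>{i, k}. c j *s row j A)"
      by (rule sum.mono_neutral_right) (use ik in \<open>auto simp: c_def\<close>)
    also have "\<dots> = 0"
      using ik(3) by (auto simp: c_def row vec_eq_iff mult.assoc) (simp add: mult.assoc[symmetric])
    finally have "\<forall>j\<in>I. c j = 0" using I unfolding left_indep_rows_def by blast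
    then have "c i = 0" "c k = 0" using ik by auto
    then show False using ik(3) by (auto simp: c_def split: if_splits)
  qed
  moreover have "left_indep_rows A {}" by (simp add: left_indep_rows_def)
  ultimately show "drank A \<le> 1" unfolding drank_def
    by (subst Max_le_iff) auto
qed

lemma drank_eq_0_iff: "drank A = 0 \<longleftrightarrow> A = 0"
proof
  assume "drank A = 0"
  show "A = 0"
  proof (rule ccontr)
    assume "A \<noteq> 0"
    then obtain i where i: "row i A \<noteq> 0" by (auto simp: vec_eq_iff row_def)
    have "left_indep_rows A {i}" unfolding left_indep_rows_def
      using i by (auto simp: vec_eq_iff)
    then have "card {i} \<le> drank A" unfolding drank_def
      by (intro Max_ge imageI) auto
    with \<open>drank A = 0\<close> show False by simp
  qed
next
  assume A: "A = 0"
  have "I = {}" if "left_indep_rows A I" for I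
    using that[unfolded left_indep_rows_def, rule_format, of "\<lambda>_. 1"]
    by (auto simp: A row_def vec_eq_iff)
  moreover have "left_indep_rows A {}" by (simp add: left_indep_rows_def)
  ultimately have "{I. left_indep_rows A I} = {{}}" by auto
  then show "drank A = 0" by (simp add: drank_def)
qed

lemma drank_eq_1_iff: "drank A = 1 \<longleftrightarrow> A \<noteq> 0 \<and> (\<exists>u w. A = outer u w)"
  unfolding drank_le_1_iff[symmetric] drank_eq_0_iff[symmetric] by auto

lemma drank_ge_2_iff: "drank A \<ge> 2 \<longleftrightarrow> (\<nexists>u w. A = outer u w)"
  unfolding drank_le_1_iff[symmetric] by auto

lemma matrix_eq_sum_outer:
  "(X :: 'a::ring_1^'n^'m) = (\<Sum>i\<in>UNIV. outer (axis i 1) (row i X))"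
  by (simp add: vec_eq_iff row_def axis_def if_distrib[of "\<lambda>t. t * _"] sum.delta cong: if_cong)

text \<open>The rows of a matrix, each paired with a unit column, sum to it. The empty sum is
  covered because zero is itself an outer product.\<close>

lemma matrix_outer_induct [case_names outer add]:
  fixes X :: "'a::ring_1^'n^'m"
  assumes outer: "\<And>x y. R (outer x y)" and add: "\<And>X Y. R X \<Longrightarrow> R Y \<Longrightarrow> R (X + Y)"
  shows "R X"
proof -
  have "R 0" using outer[of 0 0] by (simp add: outer_def zero_vec_def)
  then have "R (\<Sum>i\<in>I. outer (axis i 1) (row i X))" for I :: "'m set"
    by (induction I rule: infinite_finite_induct) (auto intro: outer add)
  then show ?thesis by (subst matrix_eq_sum_outer)
qed

section \<open>Abstract pairings with the rank-one dependence property\<close>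

text \<open>The outer product occurs below both as \<open>outer u w\<close> and with its arguments swapped; the
  first instance leads to the homomorphism, the second to the antihomomorphism.\<close>

locale rank_one_pairing =
  fixes \<beta> :: "'c::ab_group_add \<Rightarrow> 'd::ab_group_add \<Rightarrow> 'e::ab_group_add"
    and cu :: "'b::division_ring \<Rightarrow> 'c \<Rightarrow> 'c" and cw :: "'b \<Rightarrow> 'd \<Rightarrow> 'd"
  assumes add_left: "\<beta> (u + u') w = \<beta> u w + \<beta> u' w"
    and add_right: "\<beta> u (w + w') = \<beta> u w + \<beta> u w'"
    and eq_0_iff: "\<beta> u w = 0 \<longleftrightarrow> u = 0 \<or> w = 0"
    and slide: "\<beta> (cu s u) w = \<beta> u (cw s w)"
    and cu_add: "cu (s + t) u = cu s u + cu t u"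
    and cu_eq_0_iff: "cu s u = 0 \<longleftrightarrow> s = 0 \<or> u = 0"
    and cu_cu: "\<exists>r. cu t (cu s u) = cu r u"
    and cu_inverse: "s \<noteq> 0 \<Longrightarrow> cu (inverse s) (cu s u) = u"
    and dependent: "\<beta> u w + \<beta> u' w' = \<beta> u'' w'' \<Longrightarrow> u \<noteq> 0 \<Longrightarrow> w \<noteq> 0 \<Longrightarrow>
      (\<exists>s. u' = cu s u) \<or> (\<exists>s. w' = cw s w)"
begin

lemma additive_left: "Modules.additive (\<lambda>u. \<beta> u w)"
  and additive_right: "Modules.additive (\<beta> u)"
  by (simp_all add: Modules.additive_def add_left add_right)

lemmas zero_left [simp] = additive.zero[OF additive_left]
  and zero_right [simp] = additive.zero[OF additive_right]
  and diff_left = additive.diff[OF additive_left]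
  and diff_right = additive.diff[OF additive_right]
  and minus_right = additive.minus[OF additive_right]

lemma cu_diff: "cu (s - t) u = cu s u - cu t u"
  using cu_add[of "s - t" t u] by simp

lemma cancel_left: "u \<noteq> 0 \<Longrightarrow> \<beta> u w = \<beta> u w' \<longleftrightarrow> w = w'"
  using eq_0_iff[of u "w - w'"] by (simp add: diff_right)

lemma cancel_right: "w \<noteq> 0 \<Longrightarrow> \<beta> u w = \<beta> u' w \<longleftrightarrow> u = u'"
  using eq_0_iff[of "u - u'" w] by (simp add: diff_left)

text \<open>Moving \<open>\<beta> u' w'\<close> to the left gives two terms with sum zero, so
  \<open>dependent\<close> applies. If it relates the second factors, \<open>slide\<close> transfers
  the scalar to the first ones, where it can be inverted.\<close>

lemma parallel:
  assumes "\<beta> u w = \<beta> u' w'" "u \<noteq> 0" "w \<noteq> 0"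
  shows "\<exists>s. u' = cu s u"
proof -
  have "\<beta> u w + \<beta> u' (- w') = \<beta> 0 0" using assms(1) by (simp add: minus_right)
  from dependent[OF this assms(2,3)] show ?thesis
  proof
    assume "\<exists>s. - w' = cw s w"
    then obtain s where s: "- w' = cw s w" by blast
    have "\<beta> (- u) w = \<beta> (cu s u') w"
      using assms(1) s additive.minus[OF additive_left, of u w] minus_right[of u' w']
      by (simp add: slide)
    then have u: "- u = cu s u'" using assms(3) by (simp add: cancel_right)
    then have "s \<noteq> 0" using assms(2) cu_eq_0_iff[of s u'] by auto
    then have "u' = cu (inverse s) (- u)" using cu_inverse u by metis
    \<comment> \<open>The sign moves from the vector into the scalar, by sliding the scalar to the
      other factor and cancelling \<open>w\<close>.\<close>
    moreover have "cu (inverse s) (- u) = cu (- inverse s) u"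
    proof -
      have "cu (- inverse s) u = - cu (inverse s) u"
        using cu_diff[of 0 "inverse s" u] cu_eq_0_iff[of 0 u] by simp
      moreover have "\<beta> (cu (inverse s) (- u)) w = \<beta> (- cu (inverse s) u) w"
        by (simp add: slide additive.minus[OF additive_left])
      ultimately show ?thesis using assms(3) by (simp add: cancel_right)
    qed
    ultimately show ?thesis by metis
  qed
qed

text \<open>Compared with a fixed nonzero value \<open>\<beta> u0 w0\<close>, every value shares one
  of its two factors by \<open>dependent\<close>. For either factor the arguments \<open>y\<close>
  sharing it form a subgroup, so one factor serves all \<open>y\<close>.\<close>

lemma rank_one_group:
  fixes h :: "'y::ab_group_add \<Rightarrow> 'e"
  assumes "Modules.additive h" and rk: "\<And>y. \<exists>u w. h y = \<beta> u w"
  shows "(\<exists>u. \<forall>y. \<exists>w. h y = \<beta> u w) \<or> (\<exists>w. \<forall>y. \<exists>u. h y = \<beta> u w)"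
proof (cases "\<forall>y. h y = 0")
  case True
  then show ?thesis by (metis zero_left)
next
  case False
  interpret h: Modules.additive h by fact
  from False obtain y0 u0 w0 where h0: "h y0 = \<beta> u0 w0" "h y0 \<noteq> 0" using rk by metis
  then have nz: "u0 \<noteq> 0" "w0 \<noteq> 0" by auto
  have "(\<forall>y. \<exists>w. h y = \<beta> u0 w) \<or> (\<forall>y. \<exists>u. h y = \<beta> u w0)"
  proof (rule subgroup_union_UNIV)
    fix y
    obtain u w where y: "h y = \<beta> u w" using rk by blast
    obtain u'' w'' where "h (y0 + y) = \<beta> u'' w''" using rk by blast
    then have "\<beta> u0 w0 + \<beta> u w = \<beta> u'' w''" by (simp add: h.add h0 y)
    from dependent[OF this nz]
    show "(\<exists>w. h y = \<beta> u0 w) \<or> (\<exists>u. h y = \<beta> u w0)"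
      using y slide by metis
  qed (metis h.diff diff_right, metis h.diff diff_left)
  then show ?thesis by blast
qed

text \<open>Otherwise some \<open>f x1\<close> has only a common second factor \<open>w1\<close> and
  some \<open>f x2\<close> only a common first factor \<open>u2\<close>. As
  \<open>f (x1 + x2) y\<close> has rank at most one, for each \<open>y\<close> either
  \<open>f x1 y\<close> admits \<open>u2\<close> or \<open>f x2 y\<close> admits \<open>w1\<close>.
  The subgroup argument makes this uniform in \<open>y\<close>, a contradiction.\<close>

lemma rank_one_uniform:
  fixes f :: "'x::ab_group_add \<Rightarrow> 'y::ab_group_add \<Rightarrow> 'e"
  assumes f2: "\<And>x. Modules.additive (f x)" and f1: "\<And>y. Modules.additive (\<lambda>x. f x y)"
    and rk: "\<And>x y. \<exists>u w. f x y = \<beta> u w"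
  shows "(\<forall>x. \<exists>u. \<forall>y. \<exists>w. f x y = \<beta> u w) \<or> (\<forall>x. \<exists>w. \<forall>y. \<exists>u. f x y = \<beta> u w)"
proof (rule ccontr)
  assume "\<not> ?thesis"
  then obtain x1 x2 where x1: "\<not> (\<exists>u. \<forall>y. \<exists>w. f x1 y = \<beta> u w)"
    and x2: "\<not> (\<exists>w. \<forall>y. \<exists>u. f x2 y = \<beta> u w)" by blast
  obtain w1 where w1: "\<And>y. \<exists>u. f x1 y = \<beta> u w1"
    using rank_one_group[OF f2, of x1] rk x1 by blast
  obtain u2 where u2: "\<And>y. \<exists>w. f x2 y = \<beta> u2 w"
    using rank_one_group[OF f2, of x2] rk x2 by blast
  have "(\<forall>y. \<exists>w. f x1 y = \<beta> u2 w) \<or> (\<forall>y. \<exists>u. f x2 y = \<beta> u w1)"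
  proof (rule subgroup_union_UNIV)
    fix y
    obtain a where a: "f x1 y = \<beta> a w1" using w1 by blast
    obtain b where b: "f x2 y = \<beta> u2 b" using u2 by blast
    obtain u'' w'' where "f (x1 + x2) y = \<beta> u'' w''" using rk by blast
    then have e: "\<beta> a w1 + \<beta> u2 b = \<beta> u'' w''" by (simp add: additive.add[OF f1] a b)
    show "(\<exists>w. f x1 y = \<beta> u2 w) \<or> (\<exists>u. f x2 y = \<beta> u w1)"
    proof (cases "a = 0 \<or> w1 = 0 \<or> u2 = 0")
      case True
      then show ?thesis using a b by (metis zero_left zero_right)
    next
      case False
      then consider s where "u2 = cu s a" | s where "b = cw s w1" using dependent[OF e] by blast
      then show ?thesis
      proof cases
        case 1
        then have "s \<noteq> 0" using False cu_eq_0_iff by blast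
        then have "a = cu (inverse s) u2" using cu_inverse 1 by metis
        then show ?thesis using a slide by metis
      next
        case 2
        then show ?thesis using b slide by metis
      qed
    qed
  qed (metis additive.diff[OF f2] diff_right, metis additive.diff[OF f2] diff_left)
  then show False using x1 x2 by blast
qed

text \<open>If \<open>u x\<close> and \<open>u x'\<close> are independent, comparing \<open>f (x + x') y\<close> with
  \<open>f x y + f x' y\<close> shows that the second factor is the same for \<open>x\<close> and \<open>x'\<close>.\<close>

lemma rank_one_factor:
  fixes f :: "'x::ab_group_add \<Rightarrow> 'y::ab_group_add \<Rightarrow> 'e"
  assumes f2: "\<And>x. Modules.additive (f x)" and f1: "\<And>y. Modules.additive (\<lambda>x. f x y)"
    and nz: "\<And>x y. x \<noteq> 0 \<Longrightarrow> y \<noteq> 0 \<Longrightarrow> f x y \<noteq> 0"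
    and lines: "\<forall>x. \<exists>u. \<forall>y. \<exists>w. f x y = \<beta> u w"
    and nonconst: "\<nexists>u. \<forall>x y. \<exists>w. f x y = \<beta> u w"
  obtains u w where "Modules.additive u" "Modules.additive w" "\<And>x y. f x y = \<beta> (u x) (w y)"
proof -
  from nonconst obtain x0 y0 where "f x0 y0 \<noteq> 0" by (metis zero_left)
  then have x0: "x0 \<noteq> 0" and y0: "y0 \<noteq> 0"
    using additive.zero[OF f1] additive.zero[OF f2] by metis+
  \<comment> \<open>A common first factor at \<open>y0\<close> would determine the line of every
    nonzero \<open>x\<close>, because \<open>f x y0\<close> is then nonzero; this contradicts
    \<open>nonconst\<close>. Hence there is a common second factor.\<close>
  have "\<exists>v. \<forall>x. \<exists>u. f x y0 = \<beta> u v"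
  proof -
    have False if all: "\<forall>x. \<exists>w. f x y0 = \<beta> u w" for u
    proof -
      have "\<exists>w. f x y = \<beta> u w" for x y
      proof (cases "x = 0")
        case True
        then show ?thesis using additive.zero[OF f1] zero_right by metis
      next
        case False
        from lines obtain u' where u': "\<And>y. \<exists>w. f x y = \<beta> u' w" by blast
        obtain w where w: "f x y0 = \<beta> u w" using all by blast
        obtain w' where w': "f x y0 = \<beta> u' w'" using u' by blast
        note w w'
        moreover have "f x y0 \<noteq> 0" using nz False y0 .
        ultimately obtain s where "u' = cu s u"
          using parallel[of u w u' w'] eq_0_iff by metis
        then show ?thesis using u' slide by metis
      qed
      then show False using nonconst by blast
    qed
    then show ?thesis using rank_one_group[OF f1, of y0] lines by metis
  qed
  then obtain v u where u: "\<And>x. f x y0 = \<beta> (u x) v" by metis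
  have v: "v \<noteq> 0" using u[of x0] nz[OF x0 y0] by auto
  have u_nz: "u x \<noteq> 0" if "x \<noteq> 0" for x using u[of x] nz[OF that y0] by auto
  have u_add: "u (x + x') = u x + u x'" for x x'
    using u[of "x + x'"] u[of x] u[of x'] v
    by (simp add: additive.add[OF f1] add_left[symmetric] cancel_right)
  have "\<exists>w. f x y = \<beta> (u x) w" for x y
  proof (cases "x = 0")
    case True
    then show ?thesis using additive.zero[OF f1] zero_right by metis
  next
    case False
    from lines obtain u' where u': "\<And>y. \<exists>w. f x y = \<beta> u' w" by blast
    obtain w' where "\<beta> (u x) v = \<beta> u' w'" using u' u by metis
    then obtain s where "u' = cu s (u x)"
      using parallel u_nz[OF False] v by metis
    then show ?thesis using u' slide by metis
  qed
  then obtain \<mu> where \<mu>: "\<And>x y. f x y = \<beta> (u x) (\<mu> x y)" by metis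
  have indep: "\<mu> x y = \<mu> x' y" if "x \<noteq> 0" "x' \<noteq> 0" "\<nexists>s. u x' = cu s (u x)" for x x' y
  proof -
    have "\<beta> (u x + u x') (\<mu> (x + x') y) = \<beta> (u x) (\<mu> x y) + \<beta> (u x') (\<mu> x' y)"
      by (metis \<mu> u_add additive.add[OF f1])
    \<comment> \<open>Regrouped so that nonzero second factors would make \<open>u x'\<close> a
      multiple of \<open>u x\<close> by \<open>parallel\<close>.\<close>
    then have e: "\<beta> (u x) (\<mu> (x + x') y - \<mu> x y) = \<beta> (u x') (\<mu> x' y - \<mu> (x + x') y)"
      by (simp add: add_left diff_right algebra_simps)
    then have "\<mu> (x + x') y - \<mu> x y = 0"
      using parallel[OF e u_nz] that by blast
    moreover from this e have "\<mu> x' y - \<mu> (x + x') y = 0"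
      using u_nz[OF that(2)] eq_0_iff by (metis zero_right)
    ultimately show ?thesis by simp
  qed
  have const: "\<mu> x y = \<mu> x0 y" if "x \<noteq> 0" for x y
  proof (cases "\<exists>s. u x = cu s (u x0)")
    case False
    then show ?thesis using indep[OF x0 that] by metis
  next
    case True
    then obtain s where s: "u x = cu s (u x0)" by blast
    \<comment> \<open>When \<open>u x\<close> lies on the line of \<open>u x0\<close>, a vector
      \<open>x'\<close> with \<open>u x'\<close> off that line is compared with both. It exists
      because otherwise all values of \<open>f\<close> would share the first factor
      \<open>u x0\<close>.\<close>
    obtain x' where x': "\<nexists>s. u x' = cu s (u x0)"
      using nonconst \<mu> slide by metis
    have "x' \<noteq> 0"
      using x' u_add[of 0 0] cu_eq_0_iff[of 0] by (metis add_cancel_left_left)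
    moreover have "\<nexists>t. u x' = cu t (u x)"
      using x' s cu_cu by metis
    ultimately show ?thesis using indep[OF x0] indep[OF that] x' by metis
  qed
  have f: "f x y = \<beta> (u x) (\<mu> x0 y)" for x y
  proof (cases "x = 0")
    case True
    then show ?thesis using u_add[of 0 0] additive.zero[OF f1] by simp
  qed (simp add: \<mu> const)
  have "\<mu> x0 (y + y') = \<mu> x0 y + \<mu> x0 y'" for y y'
    using f[of x0 "y + y'"] f[of x0 y] f[of x0 y'] u_nz[OF x0]
    by (simp add: additive.add[OF f2] add_right[symmetric] cancel_left)
  then show ?thesis
    using that[of u "\<mu> x0"] f u_add by (simp add: Modules.additive_def)
qed

text \<open>By \<open>balanced\<close>, a scalar on \<open>x\<close> can be moved to
  \<open>y\<close>. At one nonzero pair, \<open>parallel\<close> turns this into the definition of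
  \<open>\<tau> a\<close>; cancelling a nonzero factor carries the same \<open>\<tau>\<close> to
  \<open>w\<close> everywhere and then back to \<open>u\<close>. How \<open>\<tau>\<close> treats
  products depends on the order in which \<open>cu\<close> composes, hence on the instance.\<close>

lemma rank_one_semilinear:
  fixes f :: "'a::division_ring^'m \<Rightarrow> 'a^'n \<Rightarrow> 'e"
  assumes f2: "\<And>x. Modules.additive (f x)" and f1: "\<And>y. Modules.additive (\<lambda>x. f x y)"
    and nz: "\<And>x y. x \<noteq> 0 \<Longrightarrow> y \<noteq> 0 \<Longrightarrow> f x y \<noteq> 0"
    and balanced: "\<And>a x y. f (rscale a x) y = f x (a *s y)"
    and lines: "\<forall>x. \<exists>u. \<forall>y. \<exists>w. f x y = \<beta> u w"
    and nonconst: "\<nexists>u. \<forall>x y. \<exists>w. f x y = \<beta> u w"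
  obtains u w \<tau> where "Modules.additive u" "Modules.additive w" "\<And>x y. f x y = \<beta> (u x) (w y)"
    "\<And>a x. u (rscale a x) = cu (\<tau> a) (u x)" "\<And>a y. w (a *s y) = cw (\<tau> a) (w y)"
    "Modules.additive \<tau>" "\<And>x. x \<noteq> 0 \<Longrightarrow> u x \<noteq> 0"
proof -
  obtain u w where u: "Modules.additive u" and w: "Modules.additive w"
    and f: "\<And>x y. f x y = \<beta> (u x) (w y)"
    using rank_one_factor[OF f2 f1 nz lines nonconst] by blast
  define x0 :: "'a^'m" and y0 :: "'a^'n" where "x0 = 1" and "y0 = 1"
  have nz0: "x0 \<noteq> 0" "y0 \<noteq> 0" by (simp_all add: x0_def y0_def vec_eq_iff)
  have u_nz: "u x \<noteq> 0" if "x \<noteq> 0" for x using nz[OF that nz0(2)] f[of x y0] by auto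
  have w_nz: "w y \<noteq> 0" if "y \<noteq> 0" for y using nz[OF nz0(1) that] f[of x0 y] by auto
  have "\<exists>s. u (rscale a x0) = cu s (u x0)" for a
  proof (cases "a = 0")
    case True
    then have "rscale a x0 = 0" by (simp add: vec_eq_iff)
    then show ?thesis using additive.zero[OF u] cu_eq_0_iff[of 0 "u x0"] by metis
  next
    case False
    have "\<beta> (u x0) (w (a *s y0)) = \<beta> (u (rscale a x0)) (w y0)" using balanced f by metis
    moreover have "w (a *s y0) \<noteq> 0"
      using w_nz False by (simp add: y0_def vec_eq_iff)
    ultimately show ?thesis using parallel u_nz nz0 by metis
  qed
  then obtain \<tau> where \<tau>: "\<And>a. u (rscale a x0) = cu (\<tau> a) (u x0)" by metis
  have w\<tau>: "w (a *s y) = cw (\<tau> a) (w y)" for a y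
  proof -
    have "\<beta> (u x0) (w (a *s y)) = \<beta> (u x0) (cw (\<tau> a) (w y))"
      by (metis balanced f \<tau> slide)
    then show ?thesis using u_nz nz0 by (simp add: cancel_left)
  qed
  have u\<tau>: "u (rscale a x) = cu (\<tau> a) (u x)" for a x
  proof -
    have "\<beta> (u (rscale a x)) (w y0) = \<beta> (cu (\<tau> a) (u x)) (w y0)"
      by (metis balanced f w\<tau> slide)
    then show ?thesis using w_nz nz0 by (simp add: cancel_right)
  qed
  have "\<tau> (a + b) = \<tau> a + \<tau> b" for a b
  proof -
    have "rscale (a + b) x0 = rscale a x0 + rscale b x0" by (simp add: vec_eq_iff distrib_left)
    then have "cu (\<tau> (a + b) - (\<tau> a + \<tau> b)) (u x0) = 0"
      using \<tau>[of "a + b"] by (simp add: additive.add[OF u] \<tau> cu_diff cu_add)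
    then show ?thesis using u_nz nz0 by (simp add: cu_eq_0_iff)
  qed
  then show ?thesis
    using that[OF u w f u\<tau> w\<tau> _ u_nz] by (simp add: Modules.additive_def)
qed

end

section \<open>The two orders of the factors\<close>

interpretation outer: rank_one_pairing
  "outer :: 'b::division_ring^'p \<Rightarrow> 'b^'q \<Rightarrow> 'b^'q^'p" rscale "(*s)"
proof
  fix s t :: 'b and u :: "'b^'p"
  show "\<exists>r. rscale t (rscale s u) = rscale r u"
    by (rule exI[of _ "s * t"]) (simp add: vec_eq_iff mult.assoc)
next
  fix u u' u'' :: "'b^'p" and w w' w'' :: "'b^'q"
  assume "outer u w + outer u' w' = outer u'' w''" "u \<noteq> 0" "w \<noteq> 0"
  then show "(\<exists>s. u' = rscale s u) \<or> (\<exists>s. w' = s *s w)"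
    by (rule outer_plus_outer_rank_one)
qed (auto simp: outer_add_left outer_add_right outer_eq_0_iff
  outer_rscale vec_eq_iff distrib_left mult.assoc)

text \<open>With rows as first factors, successive scalars multiply as \<open>t * s\<close> instead
  of \<open>s * t\<close>. This reversal is the source of the antihomomorphism.\<close>

interpretation swapped: rank_one_pairing
  "\<lambda>w u. outer u w :: 'b::division_ring^'q^'p" "(*s)" rscale
proof
  fix s t :: 'b and w :: "'b^'q"
  show "\<exists>r. t *s (s *s w) = r *s w"
    by (rule exI[of _ "t * s"]) (simp add: vec_eq_iff mult.assoc)
next
  fix w w' w'' :: "'b^'q" and u u' u'' :: "'b^'p"
  assume "outer u w + outer u' w' = outer u'' w''" "w \<noteq> 0" "u \<noteq> 0"
  then show "(\<exists>s. w' = s *s w) \<or> (\<exists>s. u' = rscale s u)"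
    using outer_plus_outer_rank_one by blast
qed (auto simp: outer_add_left outer_add_right outer_eq_0_iff
  outer_rscale vec_eq_iff distrib_right mult.assoc[symmetric])

section \<open>Semilinear maps in coordinates\<close>

lemma additive_eq_matrix_sum:
  fixes u :: "'a::ring_1^'m \<Rightarrow> 'b::ab_group_add"
  assumes "Modules.additive u"
  shows "u x = (\<Sum>i\<in>UNIV. u (axis i (x $ i)))"
proof -
  have "x = (\<Sum>i\<in>UNIV. axis i (x $ i))"
    by (simp add: vec_eq_iff axis_def sum.delta' cong: if_cong)
  then show ?thesis using additive.sum[OF assms] by metis
qed

lemma right_semilinear_eq:
  fixes u :: "'a::division_ring^'m \<Rightarrow> 'b::division_ring^'p"
  assumes "Modules.additive u" and "\<And>a i. u (axis i a) = rscale (\<tau> a) (u (axis i 1))"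
  shows "u x $ k = (\<Sum>i\<in>UNIV. u (axis i 1) $ k * \<tau> (x $ i))"
  by (subst additive_eq_matrix_sum[OF assms(1)], subst assms(2)) (simp add: sum_component)

lemma left_semilinear_eq:
  fixes w :: "'a::division_ring^'n \<Rightarrow> 'b::division_ring^'q"
  assumes "Modules.additive w" and "\<And>a i. w (axis i a) = \<tau> a *s w (axis i 1)"
  shows "w y $ l = (\<Sum>j\<in>UNIV. \<tau> (y $ j) * w (axis j 1) $ l)"
  by (subst additive_eq_matrix_sum[OF assms(1)], subst assms(2)) (simp add: sum_component)

lemma rscale_axis_1: "rscale a (axis i 1) = axis i (a :: 'a::ring_1)"
  and scale_axis_1: "a *s axis i 1 = axis i (a :: 'a::ring_1)"
  by (simp_all add: vec_eq_iff axis_def)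

section \<open>Graph homomorphisms on outer products, and colourings\<close>

lemma graph_hom_additive_outer:
  fixes \<phi> :: "'a::division_ring^'n^'m \<Rightarrow> 'b::division_ring^'q^'p"
  assumes add: "Modules.additive \<phi>" and "graph_hom \<phi>"
  shows "\<exists>u w. \<phi> (outer x y) = outer u w" (is ?A)
    and "x \<noteq> 0 \<Longrightarrow> y \<noteq> 0 \<Longrightarrow> \<phi> (outer x y) \<noteq> 0" (is "_ \<Longrightarrow> _ \<Longrightarrow> ?B")
proof -
  have *: "?A \<and> ?B" if "x \<noteq> 0" "y \<noteq> 0"
  proof -
    \<comment> \<open>Nonzero outer products are the neighbours of zero, and
      \<open>\<phi> 0 = 0\<close>.\<close>
    have "adjacent (outer x y) 0"
      using that unfolding adjacent_def drank_eq_1_iff by (auto simp: outer_eq_0_iff)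
    then have "adjacent (\<phi> (outer x y)) (\<phi> 0)" using assms(2) by (simp add: graph_hom_def)
    then show ?thesis
      unfolding adjacent_def drank_eq_1_iff by (simp add: additive.zero[OF add])
  qed
  then show "x \<noteq> 0 \<Longrightarrow> y \<noteq> 0 \<Longrightarrow> ?B" by blast
  show ?A
  proof (cases "x = 0 \<or> y = 0")
    case True
    then have "\<phi> (outer x y) = 0" using additive.zero[OF add] by (metis outer_eq_0_iff)
    then show ?thesis by (metis outer_eq_0_iff)
  qed (use * in blast)
qed

text \<open>By additivity a difference of two values of \<open>\<phi>\<close> is again a value,
  hence of rank at most one.\<close>

lemma colouring_rank_le_1:
  fixes \<phi> :: "'a::division_ring^'n^'m \<Rightarrow> 'b::division_ring^'q^'p"
  assumes add: "Modules.additive \<phi>" and "graph_hom \<phi>" and rk: "\<And>X. \<exists>u w. \<phi> X = outer u w"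
  shows "colouring \<phi>"
proof -
  have "adjacent (\<phi> X) (\<phi> Y)" if "\<phi> X \<noteq> \<phi> Y" for X Y
    using that rk[of "X - Y"] unfolding adjacent_def drank_eq_1_iff
    by (simp add: additive.diff[OF add])
  then show ?thesis using assms(2) by (auto simp: colouring_def adjacent_set_def)
qed

text \<open>A shared column factor survives sums, so it passes from outer products to all matrices
  and bounds the rank of every value.\<close>

lemma colouring_common_column:
  fixes \<phi> :: "'a::division_ring^'n^'m \<Rightarrow> 'b::division_ring^'q^'p"
  assumes add: "Modules.additive \<phi>" and "graph_hom \<phi>" and "\<And>x y. \<exists>w. \<phi> (outer x y) = outer u w"
  shows "colouring \<phi>"
proof (rule colouring_rank_le_1[OF assms(1,2)])
  have "\<exists>w. \<phi> X = outer u w" for X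
    by (induction X rule: matrix_outer_induct)
      (use assms(3) in \<open>metis additive.add[OF add] outer_add_right\<close>)+
  then show "\<exists>u w. \<phi> X = outer u w" for X by blast
qed

lemma colouring_common_row:
  fixes \<phi> :: "'a::division_ring^'n^'m \<Rightarrow> 'b::division_ring^'q^'p"
  assumes add: "Modules.additive \<phi>" and "graph_hom \<phi>" and "\<And>x y. \<exists>u. \<phi> (outer x y) = outer u w"
  shows "colouring \<phi>"
proof (rule colouring_rank_le_1[OF assms(1,2)])
  have "\<exists>u. \<phi> X = outer u w" for X
    by (induction X rule: matrix_outer_induct)
      (use assms(3) in \<open>metis additive.add[OF add] outer_add_left\<close>)+
  then show "\<exists>u w. \<phi> X = outer u w" for X by blast
qed

lemma additive_eq_on_outer:
  fixes \<phi> \<psi> :: "'a::ring_1^'n^'m \<Rightarrow> 'e::ab_group_add"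
  assumes "Modules.additive \<phi>" "Modules.additive \<psi>" "\<And>x y. \<phi> (outer x y) = \<psi> (outer x y)"
  shows "\<phi> X = \<psi> X"
  by (induction X rule: matrix_outer_induct) (simp_all add: assms additive.add[OF assms(1)] additive.add[OF assms(2)])

lemma additive_map_matrix:
  "Modules.additive \<tau> \<Longrightarrow> Modules.additive (map_matrix \<tau> :: _ \<Rightarrow> 'b::ring_1^'n^'m)"
  by (simp add: Modules.additive_def map_matrix_def vec_eq_iff)

lemma transpose_add: "transpose (A + B) = transpose A + transpose B"
  by (simp add: transpose_def vec_eq_iff)

lemma matrix_mult_add_mult:
  fixes P :: "'a::ring_1^'m^'p" and Q :: "'a^'q^'n"
  shows "P ** (A + B) ** Q = P ** A ** Q + P ** B ** Q"
  by (simp add: matrix_matrix_mult_def vec_eq_iff distrib_left distrib_right sum.distrib)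

text \<open>If \<open>P\<close> had rank at most one, its column factor would span a line containing
  all \<open>u x\<close>.\<close>

lemma drank_ge_2_columns:
  fixes P :: "'b::division_ring^'m^'p"
  assumes "\<And>x k. u x $ k = (\<Sum>i\<in>UNIV. P $ k $ i * g x i)" and "\<nexists>a. \<forall>x. \<exists>s. u x = rscale s a"
  shows "drank P \<ge> 2"
  unfolding drank_ge_2_iff
proof safe
  fix a b assume P: "P = outer a b"
  have "u x = rscale (\<Sum>i\<in>UNIV. b $ i * g x i) a" for x
    by (simp add: vec_eq_iff assms(1) P sum_distrib_left mult.assoc)
  then show False using assms(2) by blast
qed

lemma drank_ge_2_rows:
  fixes Q :: "'b::division_ring^'q^'n"
  assumes "\<And>y l. w y $ l = (\<Sum>j\<in>UNIV. g y j * Q $ j $ l)" and "\<nexists>b. \<forall>y. \<exists>s. w y = s *s b"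
  shows "drank Q \<ge> 2"
  unfolding drank_ge_2_iff
proof safe
  fix a b assume Q: "Q = outer a b"
  have "w y = (\<Sum>j\<in>UNIV. g y j * a $ j) *s b" for y
    by (simp add: vec_eq_iff assms(1) Q sum_distrib_right mult.assoc)
  then show False using assms(2) by blast
qed

section \<open>The homomorphism and antihomomorphism cases\<close>

theorem theorem3p1:
  fixes \<phi> :: "'a::division_ring^'n^'m \<Rightarrow> 'b::division_ring^'q^'p"
  assumes "CARD('m) \<ge> 2" and "CARD('n) \<ge> 2" and "CARD('p) \<ge> 2" and "CARD('q) \<ge> 2"
    and "Modules.additive \<phi>"
    and "graph_hom \<phi>"
  shows "(\<exists>(P :: 'b^'m^'p) (Q :: 'b^'q^'n) (\<tau> :: 'a \<Rightarrow> 'b).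
            drank P \<ge> 2 \<and> drank Q \<ge> 2 \<and> nonzero_ring_hom \<tau> \<and>
            (\<forall>X. \<phi> X = P ** map_matrix \<tau> X ** Q))
       \<or> (\<exists>(P :: 'b^'n^'p) (Q :: 'b^'q^'m) (\<sigma> :: 'a \<Rightarrow> 'b).
            drank P \<ge> 2 \<and> drank Q \<ge> 2 \<and> nonzero_ring_antihom \<sigma> \<and>
            (\<forall>X. \<phi> X = P ** transpose (map_matrix \<sigma> X) ** Q))
       \<or> colouring \<phi>"
proof (cases "colouring \<phi>")
  case False
  note add = assms(5) and hom = assms(6)
  define f where "f x y = \<phi> (outer x y)" for x y
  have f2: "Modules.additive (f x)" and f1: "Modules.additive (\<lambda>x. f x y)" for x y
    by (simp_all add: f_def Modules.additive_def outer_add_left outer_add_right additive.add[OF add])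
  have rk: "\<exists>u w. f x y = outer u w" for x y
    using graph_hom_additive_outer(1)[OF add hom] by (simp add: f_def)
  have nz: "f x y \<noteq> 0" if "x \<noteq> 0" "y \<noteq> 0" for x y
    using graph_hom_additive_outer(2)[OF add hom that] by (simp add: f_def)
  have bal: "f (rscale a x) y = f x (a *s y)" for a x y by (simp add: f_def outer_rscale)
  \<comment> \<open>\<open>nc1\<close> and \<open>nc2\<close> make the factorization possible and
    later force \<open>P\<close> and \<open>Q\<close> to have rank at least two.\<close>
  have nc1: "\<nexists>u. \<forall>x y. \<exists>w. f x y = outer u w"
    using colouring_common_column[OF add hom] False unfolding f_def by blast
  have nc2: "\<nexists>w. \<forall>x y. \<exists>u. f x y = outer u w"
    using colouring_common_row[OF add hom] False unfolding f_def by blast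
  from outer.rank_one_uniform[OF f2 f1 rk] show ?thesis
  proof
    assume lines: "\<forall>x. \<exists>u. \<forall>y. \<exists>w. f x y = outer u w"
    show ?thesis
    proof (rule outer.rank_one_semilinear[OF f2 f1 nz bal lines nc1])
      fix u w \<tau>
      assume u: "Modules.additive u" and w: "Modules.additive w"
        and f: "\<And>x y. f x y = outer (u x) (w y)"
        and us: "\<And>a x. u (rscale a x) = rscale (\<tau> a) (u x)" and ws: "\<And>a y. w (a *s y) = \<tau> a *s w y"
        and \<tau>: "Modules.additive \<tau>" and u_nz: "\<And>x. x \<noteq> 0 \<Longrightarrow> u x \<noteq> 0"
      define P :: "'b^'m^'p" where "P = (\<chi> k i. u (axis i 1) $ k)"
      define Q :: "'b^'q^'n" where "Q = (\<chi> j l. w (axis j 1) $ l)"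
      have uP: "u x $ k = (\<Sum>i\<in>UNIV. P $ k $ i * \<tau> (x $ i))" for x k
      proof -
        have "u (axis i a) = rscale (\<tau> a) (u (axis i 1))" for a i
          using us[of a "axis i 1"] by (simp add: rscale_axis_1)
        then show ?thesis unfolding P_def vec_lambda_beta by (rule right_semilinear_eq[OF u])
      qed
      have wQ: "w y $ l = (\<Sum>j\<in>UNIV. \<tau> (y $ j) * Q $ j $ l)" for y l
      proof -
        have "w (axis i a) = \<tau> a *s w (axis i 1)" for a i
          using ws[of a "axis i 1"] by (simp add: scale_axis_1)
        then show ?thesis unfolding Q_def vec_lambda_beta by (rule left_semilinear_eq[OF w])
      qed
      have "drank P \<ge> 2"
      proof (rule drank_ge_2_columns[OF uP])
        show "\<nexists>a. \<forall>x. \<exists>s. u x = rscale s a" using nc1 by (metis f outer_rscale)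
      qed
      moreover have "drank Q \<ge> 2"
      proof (rule drank_ge_2_rows[OF wQ])
        show "\<nexists>b. \<forall>y. \<exists>s. w y = s *s b" using nc2 by (metis f outer_rscale)
      qed
      moreover obtain k where k: "u 1 $ k \<noteq> 0"
        using u_nz[of 1] by (auto simp: vec_eq_iff)
      \<comment> \<open>Scalars act on columns from the right both in the argument and in the image,
        so the order of the product is kept. The nonzero entry \<open>k\<close> can be
        cancelled.\<close>
      have mult: "\<tau> (a * b) = \<tau> a * \<tau> b" for a b
      proof -
        have "u (rscale (a * b) 1) = u (rscale b (rscale a 1))"
          by (rule arg_cong[of _ _ u]) (simp add: vec_eq_iff)
        then have "rscale (\<tau> (a * b)) (u 1) = rscale (\<tau> b) (rscale (\<tau> a) (u 1))"
          by (simp only: us)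
        then show ?thesis using k by (auto simp: vec_eq_iff mult.assoc)
      qed
      have "\<tau> 1 \<noteq> 0"
      proof
        assume "\<tau> 1 = 0"
        then have "u (rscale 1 1) $ k = 0" by (simp only: us rscale_nth mult_zero_right)
        then show False using k by simp
      qed
      then have "nonzero_ring_hom \<tau>"
        using mult additive.add[OF \<tau>] by (auto simp: nonzero_ring_hom_def)
      \<comment> \<open>Both sides are additive in \<open>X\<close>, so they need comparing only on
        outer products, which \<open>map_matrix \<tau>\<close> respects by multiplicativity.\<close>
      moreover have "\<phi> X = P ** map_matrix \<tau> X ** Q" for X
      proof (rule additive_eq_on_outer[OF add])
        show "Modules.additive (\<lambda>X. P ** map_matrix \<tau> X ** Q)"
          by (simp add: Modules.additive_def matrix_mult_add_mult
              additive.add[OF additive_map_matrix[OF \<tau>]])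
        fix x :: "'a^'m" and y :: "'a^'n"
        have "map_matrix \<tau> (outer x y) = outer (\<chi> i. \<tau> (x $ i)) (\<chi> j. \<tau> (y $ j))"
          by (simp add: vec_eq_iff map_matrix_def mult)
        then show "\<phi> (outer x y) = P ** map_matrix \<tau> (outer x y) ** Q"
          by (simp add: f[unfolded f_def] matrix_mult_outer_mult) (simp add: vec_eq_iff uP wQ)
      qed
      ultimately show ?thesis by blast
    qed
  next
    assume lines: "\<forall>x. \<exists>w. \<forall>y. \<exists>u. f x y = outer u w"
    show ?thesis
    \<comment> \<open>The row factor now comes from the column \<open>x\<close> and the column
      factor from the row \<open>y\<close>; this exchange yields the transpose.\<close>
    proof (rule swapped.rank_one_semilinear[OF f2 f1 nz bal lines nc2])
      fix w u \<sigma>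
      assume w: "Modules.additive w" and u: "Modules.additive u"
        and f: "\<And>x y. f x y = outer (u y) (w x)"
        and ws: "\<And>a x. w (rscale a x) = \<sigma> a *s w x" and us: "\<And>a y. u (a *s y) = rscale (\<sigma> a) (u y)"
        and \<sigma>: "Modules.additive \<sigma>" and w_nz: "\<And>x. x \<noteq> 0 \<Longrightarrow> w x \<noteq> 0"
      define P :: "'b^'n^'p" where "P = (\<chi> k j. u (axis j 1) $ k)"
      define Q :: "'b^'q^'m" where "Q = (\<chi> i l. w (axis i 1) $ l)"
      have uP: "u y $ k = (\<Sum>j\<in>UNIV. P $ k $ j * \<sigma> (y $ j))" for y k
      proof -
        have "u (axis i a) = rscale (\<sigma> a) (u (axis i 1))" for a i
          using us[of a "axis i 1"] by (simp add: scale_axis_1)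
        then show ?thesis unfolding P_def vec_lambda_beta by (rule right_semilinear_eq[OF u])
      qed
      have wQ: "w x $ l = (\<Sum>i\<in>UNIV. \<sigma> (x $ i) * Q $ i $ l)" for x l
      proof -
        have "w (axis i a) = \<sigma> a *s w (axis i 1)" for a i
          using ws[of a "axis i 1"] by (simp add: rscale_axis_1)
        then show ?thesis unfolding Q_def vec_lambda_beta by (rule left_semilinear_eq[OF w])
      qed
      have "drank P \<ge> 2"
      proof (rule drank_ge_2_columns[OF uP])
        show "\<nexists>a. \<forall>y. \<exists>s. u y = rscale s a" using nc1 by (metis f outer_rscale)
      qed
      moreover have "drank Q \<ge> 2"
      proof (rule drank_ge_2_rows[OF wQ])
        show "\<nexists>b. \<forall>x. \<exists>s. w x = s *s b" using nc2 by (metis f outer_rscale)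
      qed
      moreover obtain l where l: "w 1 $ l \<noteq> 0"
        using w_nz[of 1] by (auto simp: vec_eq_iff)
      \<comment> \<open>Right scalars on the argument become left scalars on the image row, which
        reverses the product.\<close>
      have mult: "\<sigma> (a * b) = \<sigma> b * \<sigma> a" for a b
      proof -
        have "w (rscale (a * b) 1) = w (rscale b (rscale a 1))"
          by (rule arg_cong[of _ _ w]) (simp add: vec_eq_iff)
        then have "\<sigma> (a * b) *s w 1 = \<sigma> b *s (\<sigma> a *s w 1)"
          by (simp only: ws)
        then show ?thesis using l by (auto simp: vec_eq_iff mult.assoc[symmetric])
      qed
      have "\<sigma> 1 \<noteq> 0"
      proof
        assume "\<sigma> 1 = 0"
        then have "w (rscale 1 1) $ l = 0" by (simp only: ws vector_smult_component mult_zero_left)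
        then show False using l by simp
      qed
      then have "nonzero_ring_antihom \<sigma>"
        using mult additive.add[OF \<sigma>] by (auto simp: nonzero_ring_antihom_def)
      moreover have "\<phi> X = P ** transpose (map_matrix \<sigma> X) ** Q" for X
      proof (rule additive_eq_on_outer[OF add])
        show "Modules.additive (\<lambda>X. P ** transpose (map_matrix \<sigma> X) ** Q)"
          by (simp add: Modules.additive_def matrix_mult_add_mult transpose_add
              additive.add[OF additive_map_matrix[OF \<sigma>]])
        fix x :: "'a^'m" and y :: "'a^'n"
        have "transpose (map_matrix \<sigma> (outer x y)) = outer (\<chi> j. \<sigma> (y $ j)) (\<chi> i. \<sigma> (x $ i))"
          by (simp add: vec_eq_iff map_matrix_def transpose_def mult)
        then show "\<phi> (outer x y) = P ** transpose (map_matrix \<sigma> (outer x y)) ** Q"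
          by (simp add: f[unfolded f_def] matrix_mult_outer_mult) (simp add: vec_eq_iff uP wQ)
      qed
      ultimately show ?thesis by blast
    qed
  qed
qed blast

end
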